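(* Any proper $EMV$-algebra $M$ has at least one maximal ideal. In addition, if $F$ is a maximal filter of a proper $EMV$-algebra $M$, then $$I_F:=\{\lambda_a(x)\mid x\in F,\ a\in\mathcal I(M),\ x\le a\}$$ is a maximal ideal of $M$.
   Context: An algebra $(M;\vee,\wedge,\oplus,0)$ of type $(2,2,2,0)$ is an $EMV$-algebra if: (1) $(M;\vee,\wedge,0)$ is a distributive lattice with least element $0$; (2) $(M;\oplus,0)$ is a commutative ordered monoid with neutral element $0$; (3) writing $\mathcal I(M)=\{a\in M: a\oplus a=a\}$, for all $a\le b$ in $\mathcal I(M)$ and all $x\in[a,b]$ the element $\lambda_{a,b}(x)=\min\{z\in[a,b]: x\oplus z=b\}$ exists in $M$, and $([a,b];\oplus,\lambda_{a,b},a,b)$ is an $MV$-algebra; (4) each $x\in M$ lies below some $a\in\mathcal I(M)$. We write $\lambda_b:=\lambda_{0,b}$. An $EMV$-algebra is proper if it has no greatest element. For $x,y\in M$ put $x\odot y=\lambda_a(\lambda_a(x)\oplus\lambda_a(y))$, where $a\in\mathcal I(M)$ with $x,y\le a$; this does not depend on the choice of $a$. An ideal of $M$ is a non-empty down-closed subset closed under $\oplus$; it is maximal if it is proper (different from $M$) and for every $x\in M\setminus I$ the ideal generated by $I\cup\{x\}$ is $M$. A filter of $M$ is a non-empty up-closed subset closed under $\odot$; a filter $F$ is proper if $F\ne M$, and a maximal filter is a proper filter that is not a proper subset of another proper filter. *)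

theory Defs
  imports Complex_Main
begin

text \<open>
  MV-algebras are given on an explicit carrier, because they occur below as the
  intervals \<open>[a,b]\<close> of a larger algebra.
\<close>

locale mv_algebra =
  fixes A :: "'a set"
    and oplus :: "'a \<Rightarrow> 'a \<Rightarrow> 'a"
    and compl :: "'a \<Rightarrow> 'a"
    and zero :: 'a
    and unit :: 'a
  assumes zero_closed: "zero \<in> A"
    and unit_closed: "unit \<in> A"
    and oplus_closed: "\<lbrakk>x \<in> A; y \<in> A\<rbrakk> \<Longrightarrow> oplus x y \<in> A"
    and compl_closed: "x \<in> A \<Longrightarrow> compl x \<in> A"
    and oplus_assoc: "\<lbrakk>x \<in> A; y \<in> A; z \<in> A\<rbrakk> \<Longrightarrow> oplus (oplus x y) z = oplus x (oplus y z)"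
    and oplus_commute: "\<lbrakk>x \<in> A; y \<in> A\<rbrakk> \<Longrightarrow> oplus x y = oplus y x"
    and oplus_zero: "x \<in> A \<Longrightarrow> oplus x zero = x"
    and compl_compl: "x \<in> A \<Longrightarrow> compl (compl x) = x"
    and compl_zero: "compl zero = unit"
    and oplus_unit: "x \<in> A \<Longrightarrow> oplus x unit = unit"
    and lukasiewicz: "\<lbrakk>x \<in> A; y \<in> A\<rbrakk> \<Longrightarrow>
          oplus (compl (oplus (compl x) y)) y = oplus (compl (oplus (compl y) x)) x"

text \<open>
  An EMV-algebra \<open>M\<close> is a type with \<open>\<or>, \<and>, \<oplus>, 0\<close> written as \<^const>\<open>sup\<close>,
  \<^const>\<open>inf\<close>, \<open>+\<close>, \<open>0\<close>, so that \<open>M\<close> itself is \<^term>\<open>UNIV\<close>.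
\<close>

definition (in ordered_comm_monoid_add) emv_idem :: "'a set" where
  "emv_idem = {a. a + a = a}"

text \<open>
  \<open>emv_lam a b x\<close> is \<open>\<lambda>\<^sub>a\<^sub>,\<^sub>b(x)\<close>; \<open>LEAST\<close> is meaningful only when the minimum exists,
  which is part of the axioms of the class below.
\<close>

definition (in ordered_comm_monoid_add) emv_lam :: "'a \<Rightarrow> 'a \<Rightarrow> 'a \<Rightarrow> 'a" where
  "emv_lam a b x = (LEAST z. z \<in> {a..b} \<and> x + z = b)"

class emv_algebra = distrib_lattice + ordered_comm_monoid_add +
  assumes zero_least: "0 \<le> x"
    and emv_lam_exists: "\<lbrakk>a \<in> emv_idem; b \<in> emv_idem; a \<le> b; x \<in> {a..b}\<rbrakk> \<Longrightarrow>
          \<exists>z. z \<in> {a..b} \<and> x + z = b \<and> (\<forall>w. w \<in> {a..b} \<and> x + w = b \<longrightarrow> z \<le> w)"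
    and interval_mv_algebra: "\<lbrakk>a \<in> emv_idem; b \<in> emv_idem; a \<le> b\<rbrakk> \<Longrightarrow>
          mv_algebra {a..b} (+) (emv_lam a b) a b"
    and idem_above: "\<exists>a \<in> emv_idem. x \<le> a"

context emv_algebra
begin

text \<open>The value of \<open>x \<odot> y\<close> does not depend on the idempotent chosen here.\<close>

definition emv_odot :: "'a \<Rightarrow> 'a \<Rightarrow> 'a" where
  "emv_odot x y =
    (let a = (SOME a. a \<in> emv_idem \<and> x \<le> a \<and> y \<le> a)
     in emv_lam 0 a (emv_lam 0 a x + emv_lam 0 a y))"

definition emv_ideal :: "'a set \<Rightarrow> bool" where
  "emv_ideal I \<longleftrightarrow> I \<noteq> {} \<and> (\<forall>x y. y \<in> I \<and> x \<le> y \<longrightarrow> x \<in> I) \<and>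
     (\<forall>x\<in>I. \<forall>y\<in>I. x + y \<in> I)"

definition emv_maximal_ideal :: "'a set \<Rightarrow> bool" where
  "emv_maximal_ideal I \<longleftrightarrow> emv_ideal I \<and> I \<noteq> UNIV \<and>
     (\<forall>x. x \<notin> I \<longrightarrow> emv_ideal hull (I \<union> {x}) = UNIV)"

definition emv_filter :: "'a set \<Rightarrow> bool" where
  "emv_filter F \<longleftrightarrow> F \<noteq> {} \<and> (\<forall>x y. x \<in> F \<and> x \<le> y \<longrightarrow> y \<in> F) \<and>
     (\<forall>x\<in>F. \<forall>y\<in>F. emv_odot x y \<in> F)"

definition emv_maximal_filter :: "'a set \<Rightarrow> bool" where
  "emv_maximal_filter F \<longleftrightarrow> emv_filter F \<and> F \<noteq> UNIV \<and>
     \<not> (\<exists>G. emv_filter G \<and> G \<noteq> UNIV \<and> F \<subset> G)"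

definition emv_ideal_of :: "'a set \<Rightarrow> 'a set" where
  "emv_ideal_of F = {emv_lam 0 a x |x a. x \<in> F \<and> a \<in> emv_idem \<and> x \<le> a}"

end

end

theory Submission
  imports Defs
begin

text \<open>
  Each interval \<open>[0,a]\<close> with \<open>a\<close> idempotent is an MV-algebra whose natural order is the lattice
  order, so \<open>x + _\<close> has a lower adjoint. Hence \<open>+\<close> distributes over meets, which yields
  \<open>\<lambda>\<^sub>a(x) = \<lambda>\<^sub>b(x) \<and> a\<close> for \<open>x \<le> a \<le> b\<close> and the independence of \<open>\<odot>\<close> from the chosen idempotent.

  An ideal \<open>J\<close> containing \<open>I\<^sub>F\<close> and some \<open>x \<notin> I\<^sub>F\<close> contains every idempotent \<open>a \<in> F\<close> above \<open>x\<close>: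
  the set \<open>{z. \<lambda>\<^sub>a(z \<and> a) \<in> J}\<close> is a filter containing \<open>F\<close> and \<open>\<lambda>\<^sub>a(x) \<notin> F\<close>, so by maximality it
  contains \<open>0\<close>. Such \<open>a\<close> are cofinal in \<open>M\<close>. Maximal filters exist by Zorn's lemma because, unlike
  for ideals, properness of a filter is the single condition \<open>0 \<notin> F\<close>.
\<close>

context emv_algebra
begin

section \<open>Complements in the intervals \<open>[0,a]\<close>\<close>

abbreviation lam :: "'a \<Rightarrow> 'a \<Rightarrow> 'a" where
  "lam \<equiv> emv_lam 0"

lemma idem_zero: "0 \<in> emv_idem"
  by (simp add: emv_idem_def)

lemma idem_add: "a \<in> emv_idem \<Longrightarrow> a + a = a"
  by (simp add: emv_idem_def)

lemma le_add_left: "x \<le> x + y"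
  using add_left_mono[OF zero_least, of x y] by simp

lemma le_add_right: "y \<le> x + y"
  using le_add_left[of y x] by (simp add: add_commute)

lemma add_le_idem: "\<lbrakk>a \<in> emv_idem; x \<le> a; y \<le> a\<rbrakk> \<Longrightarrow> x + y \<le> a"
  using add_mono[of x a y a] by (simp add: idem_add)

lemma ex_idem_above2: "\<exists>a\<in>emv_idem. x \<le> a \<and> y \<le> a"
  using idem_above[of "sup x y"] by auto

lemma ex_idem_above3: "\<exists>a\<in>emv_idem. x \<le> a \<and> y \<le> a \<and> z \<le> a"
  using idem_above[of "sup x (sup y z)"] by auto

lemma interval_mv: "a \<in> emv_idem \<Longrightarrow> mv_algebra {0..a} (+) (lam a) 0 a"
  by (rule interval_mv_algebra) (auto simp: idem_zero zero_least)

lemma lam_props: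
  assumes "a \<in> emv_idem" "x \<le> a"
  shows lam_le: "lam a x \<le> a"
    and add_lam: "x + lam a x = a"
    and lam_least: "\<And>w. w \<le> a \<Longrightarrow> x + w = a \<Longrightarrow> lam a x \<le> w"
proof -
  obtain z where z: "z \<in> {0..a}" "x + z = a" "\<And>w. w \<in> {0..a} \<and> x + w = a \<Longrightarrow> z \<le> w"
    using emv_lam_exists[OF idem_zero assms(1) zero_least, of x] assms(2) zero_least by auto
  have "lam a x = z"
    unfolding emv_lam_def by (rule Least_equality) (use z in auto)
  with z show "lam a x \<le> a" "x + lam a x = a"
    "\<And>w. w \<le> a \<Longrightarrow> x + w = a \<Longrightarrow> lam a x \<le> w"
    using zero_least by auto
qed

lemma lam_lam: "\<lbrakk>a \<in> emv_idem; x \<le> a\<rbrakk> \<Longrightarrow> lam a (lam a x) = x"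
  using mv_algebra.compl_compl[OF interval_mv] zero_least by auto

lemma lam_zero: "a \<in> emv_idem \<Longrightarrow> lam a 0 = a"
  using mv_algebra.compl_zero[OF interval_mv] by auto

lemma lam_idem: "a \<in> emv_idem \<Longrightarrow> lam a a = 0"
  using lam_lam[of a 0] zero_least by (simp add: lam_zero)

section \<open>Natural order and residuation\<close>

lemma le_iff_lam_add:
  assumes "a \<in> emv_idem" "x \<le> a" "y \<le> a"
  shows "x \<le> y \<longleftrightarrow> lam a x + y = a"
proof
  assume "x \<le> y"
  then have "lam a x + x \<le> lam a x + y"
    by (rule add_left_mono)
  then show "lam a x + y = a"
    using assms add_le_idem lam_le add_lam[of a x] by (auto simp: add_commute intro: order.antisym)
next
  assume "lam a x + y = a"
  \<comment> \<open>Among the \<open>w\<close> with \<open>lam a x + w = a\<close>, the complement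
    of \<open>lam a x\<close> is the least, and it is \<open>x\<close> by involution.\<close>
  then have "lam a (lam a x) \<le> y"
    using assms lam_le by (auto intro!: lam_least[of a "lam a x" y])
  then show "x \<le> y"
    using assms by (simp add: lam_lam)
qed

lemma lam_antimono: "\<lbrakk>a \<in> emv_idem; y \<le> a; x \<le> y\<rbrakk> \<Longrightarrow> lam a y \<le> lam a x"
  using le_iff_lam_add[of a x y] lam_le[of a x] order.trans[of x y a]
  by (auto simp: add_commute intro!: lam_least[of a y "lam a x"])

text \<open>A Galois connection on \<open>[0,a]\<close>: the truncated difference of
  \<open>z\<close> and \<open>x\<close> is \<open>lam a (lam a z + x)\<close>. It follows by
  reassociating \<open>lam a z + (x + y) = a\<close>.\<close>

lemma le_add_iff_diff_le:
  assumes "a \<in> emv_idem" "x \<le> a" "y \<le> a" "z \<le> a"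
  shows "z \<le> x + y \<longleftrightarrow> lam a (lam a z + x) \<le> y"
proof -
  have "z \<le> x + y \<longleftrightarrow> lam a z + (x + y) = a"
    using assms by (intro le_iff_lam_add add_le_idem)
  also have "\<dots> \<longleftrightarrow> lam a (lam a (lam a z + x)) + y = a"
    using assms by (simp add: lam_lam lam_le add_le_idem add_assoc)
  also have "\<dots> \<longleftrightarrow> lam a (lam a z + x) \<le> y"
    using assms by (intro le_iff_lam_add[symmetric] lam_le add_le_idem)
  finally show ?thesis .
qed

lemma add_inf_distrib: "x + inf y z = inf (x + y) (x + z)"
proof (rule order.antisym)
  show "x + inf y z \<le> inf (x + y) (x + z)"
    by (simp add: add_left_mono)
next
  obtain a where a: "a \<in> emv_idem" "x \<le> a" "y \<le> a" "z \<le> a"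
    using ex_idem_above3 by blast
  let ?w = "inf (x + y) (x + z)"
  have w: "?w \<le> a"
    using a add_le_idem le_infI1 by blast
  \<comment> \<open>The difference of \<open>?w\<close> and \<open>x\<close> lies below both
    \<open>y\<close> and \<open>z\<close>, because \<open>?w\<close> lies below both sums.\<close>
  have "lam a (lam a ?w + x) \<le> inf y z"
    using le_add_iff_diff_le[OF a(1,2) _ w] a by (metis inf.cobounded1 inf.cobounded2 le_infI)
  then show "?w \<le> x + inf y z"
    using le_add_iff_diff_le[OF a(1,2) _ w] a by (meson le_infI1)
qed

section \<open>Truncation at idempotents and change of interval\<close>

lemma inf_add_le: "inf (u + v) w \<le> inf u w + inf v w"
proof -
  \<comment> \<open>Inserting \<open>u + w\<close>, which is above \<open>w\<close>, creates a meet
    out of which \<open>u\<close> can be factored; afterwards \<open>inf v w\<close> is factored out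
    in the same way.\<close>
  have "inf (u + v) w \<le> inf (inf (u + v) (u + w)) w"
    by (simp add: le_infI2 le_add_right)
  also have "\<dots> \<le> inf (u + inf v w) (w + inf v w)"
    unfolding add_inf_distrib[of u] using le_add_left by (intro inf_mono order.refl)
  also have "\<dots> = inf u w + inf v w"
    by (simp only: add_inf_distrib[of "inf v w"] add_commute[of _ "inf v w"])
  finally show ?thesis .
qed

text \<open>The Lukasiewicz axiom identifies the join of an MV-algebra with \<open>\<lambda>(\<lambda>x + y) + y\<close>.\<close>

lemma add_idem_eq_sup:
  assumes "a \<in> emv_idem"
  shows "x + a = sup x a"
proof (rule order.antisym)
  show "sup x a \<le> x + a"
    by (simp add: le_add_left le_add_right)
next
  obtain b where b: "b \<in> emv_idem" "x \<le> b" "a \<le> b"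
    using ex_idem_above2 by blast
  interpret mv_algebra "{0..b}" "(+)" "lam b" 0 b
    by (rule interval_mv) (fact b)
  define j where "j = (\<lambda>u. lam b (lam b u + a) + a)"
  have j: "j u = lam b (lam b a + u) + u" if "u \<le> b" for u
    using lukasiewicz[of u a] that b zero_least by (auto simp: j_def)
  let ?s = "sup x a"
  have s: "?s \<le> b"
    using b by simp
  \<comment> \<open>Since \<open>a \<le> ?s\<close>, the second form of \<open>j ?s\<close>
    collapses to \<open>0 + ?s\<close>. The first form ends in \<open>+ a\<close> and so absorbs a
    further \<open>a\<close>.\<close>
  have "lam b a + ?s = b"
    using le_iff_lam_add[of b a ?s] b s by simp
  then have js: "j ?s = ?s"
    using s b by (simp add: j lam_idem)
  have "x + a \<le> ?s + a"
    by (simp add: add_right_mono)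
  also have "\<dots> = j ?s + a"
    by (simp add: js)
  also have "\<dots> = j ?s"
    unfolding j_def by (simp only: add_assoc idem_add[OF assms])
  also have "\<dots> = ?s"
    by (fact js)
  finally show "x + a \<le> ?s" .
qed

text \<open>Idempotents are Boolean in \<open>[0,b]\<close>: the complement of the meet dominates
  both \<open>lam b a\<close> and \<open>a\<close>, hence their join, which by
  \<open>add_idem_eq_sup\<close> is their sum \<open>b\<close>.\<close>

lemma inf_lam_idem:
  assumes "a \<in> emv_idem" "b \<in> emv_idem" "a \<le> b"
  shows "inf a (lam b a) = 0"
proof -
  let ?d = "inf a (lam b a)"
  have d: "?d \<le> b"
    using assms by (simp add: le_infI1)
  have "lam b a \<le> lam b ?d" "lam b (lam b a) \<le> lam b ?d"
    using assms by (auto intro!: lam_antimono lam_le)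
  then have "sup (lam b a) a \<le> lam b ?d"
    using assms by (simp add: lam_lam)
  then have "b \<le> lam b ?d"
    using assms by (simp add: add_idem_eq_sup[symmetric] add_commute add_lam)
  then have "lam b ?d = b"
    using lam_le[OF assms(2) d] by (rule order.antisym[rotated])
  then show ?thesis
    using lam_lam[OF assms(2) d] assms by (simp add: lam_idem)
qed

text \<open>Both halves rest on minimality: \<open>inf (lam b x) a\<close> completes
  \<open>x\<close> to \<open>a\<close>, and \<open>lam a x + lam b a\<close> completes
  \<open>x\<close> to \<open>b\<close>. Cutting the latter sum at \<open>a\<close> removes
  \<open>lam b a\<close>.\<close>

lemma lam_restrict:
  assumes "a \<in> emv_idem" "b \<in> emv_idem" "a \<le> b" "x \<le> a"
  shows "lam a x = inf (lam b x) a"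
proof (rule order.antisym)
  have x: "x \<le> b"
    using assms by auto
  have "x + a = a"
    using assms by (simp add: add_idem_eq_sup sup.absorb2)
  then have "x + inf (lam b x) a = a"
    using assms x by (simp add: add_inf_distrib add_lam inf.absorb2)
  then show "lam a x \<le> inf (lam b x) a"
    using assms by (intro lam_least[of a x "inf (lam b x) a"]) auto
  have "x + (lam a x + lam b a) = b"
    using assms by (simp add: add_assoc[symmetric] add_lam)
  then have "lam b x \<le> lam a x + lam b a"
    using assms x lam_le[of a x]
    by (intro lam_least[of b x "lam a x + lam b a"] add_le_idem lam_le[of b a]) auto
  then have "inf (lam b x) a \<le> inf (lam a x + lam b a) a"
    by (rule inf_mono) simp
  also have "\<dots> \<le> inf (lam a x) a + inf (lam b a) a"
    by (rule inf_add_le)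
  also have "\<dots> = lam a x"
    using assms by (simp add: inf_lam_idem inf_commute[of _ a] inf.absorb2 lam_le)
  finally show "inf (lam b x) a \<le> lam a x" .
qed

lemma lam_mono_idem:
  "\<lbrakk>a \<in> emv_idem; b \<in> emv_idem; a \<le> b; x \<le> a\<rbrakk> \<Longrightarrow> lam a x \<le> lam b x"
  using lam_restrict[of a b x] by simp

section \<open>The product \<odot> and its independence of the idempotent\<close>

lemma odot_le_iff:
  assumes "a \<in> emv_idem" "x \<le> a" "y \<le> a"
  shows "lam a (lam a x + lam a y) \<le> z \<longleftrightarrow> x \<le> lam a y + z"
proof -
  let ?p = "lam a (lam a x + lam a y)"
  have y: "lam a y \<le> a" and p: "?p \<le> a"
    using assms by (auto intro!: lam_le add_le_idem)
  \<comment> \<open>\<open>?p\<close> is the difference of \<open>x\<close> and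
    \<open>lam a y\<close>, so the adjunction applies once \<open>z\<close> is cut at
    \<open>a\<close>. Allowing arbitrary \<open>z\<close> lets products from different intervals be
    compared.\<close>
  have "?p \<le> z \<longleftrightarrow> ?p \<le> inf z a"
    using p by simp
  also have "\<dots> \<longleftrightarrow> x \<le> lam a y + inf z a"
    using le_add_iff_diff_le[OF assms(1) y _ assms(2), of "inf z a"] by simp
  also have "\<dots> \<longleftrightarrow> x \<le> lam a y + z"
    using assms(2) le_add_right[of a "lam a y"] by (auto simp: add_inf_distrib)
  finally show ?thesis .
qed

lemma odot_mono_idem:
  assumes "a \<in> emv_idem" "b \<in> emv_idem" "a \<le> b" "x \<le> a" "y \<le> a"
  shows "lam a (lam a x + lam a y) = lam b (lam b x + lam b y)"
proof -
  have xy: "x \<le> b" "y \<le> b"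
    using assms by auto
  \<comment> \<open>By \<open>odot_le_iff\<close>, this says that both products have the same upper
    bounds.\<close>
  have "x \<le> lam a y + z \<longleftrightarrow> x \<le> lam b y + z" for z
  proof
    assume "x \<le> lam a y + z"
    also have "\<dots> \<le> lam b y + z"
      using assms by (intro add_right_mono lam_mono_idem)
    finally show "x \<le> lam b y + z" .
  next
    assume "x \<le> lam b y + z"
    then have "x \<le> inf (lam b y + z) a"
      using assms by simp
    also have "\<dots> \<le> inf (lam b y) a + inf z a"
      by (rule inf_add_le)
    also have "\<dots> \<le> lam a y + z"
      using assms by (simp add: lam_restrict[symmetric] add_left_mono)
    finally show "x \<le> lam a y + z" .
  qed
  then show ?thesis
    using odot_le_iff[OF assms(1,4,5)] odot_le_iff[OF assms(2) xy]
    by (metis order.antisym order.refl)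
qed

lemma odot_eq:
  assumes "a \<in> emv_idem" "x \<le> a" "y \<le> a"
  shows "emv_odot x y = lam a (lam a x + lam a y)"
proof -
  define c where "c = (SOME c. c \<in> emv_idem \<and> x \<le> c \<and> y \<le> c)"
  have c: "c \<in> emv_idem \<and> x \<le> c \<and> y \<le> c"
    unfolding c_def by (rule someI_ex) (use assms in blast)
  \<comment> \<open>\<open>a\<close> and the chosen \<open>c\<close> may be incomparable, so both
    values are compared in a larger interval.\<close>
  obtain b where b: "b \<in> emv_idem" "a \<le> b" "c \<le> b"
    using ex_idem_above2 by blast
  have "emv_odot x y = lam c (lam c x + lam c y)"
    by (simp add: emv_odot_def c_def Let_def)
  also have "\<dots> = lam b (lam b x + lam b y)"
    using b c by (intro odot_mono_idem) auto
  also have "\<dots> = lam a (lam a x + lam a y)"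
    using b assms by (intro odot_mono_idem[symmetric]) auto
  finally show ?thesis .
qed

lemma odot_lam_lam:
  "\<lbrakk>a \<in> emv_idem; x \<le> a; y \<le> a\<rbrakk> \<Longrightarrow> emv_odot (lam a x) (lam a y) = lam a (x + y)"
  by (simp add: odot_eq[of a] lam_le lam_lam)

lemma odot_mono:
  assumes "x \<le> x'" "y \<le> y'"
  shows "emv_odot x y \<le> emv_odot x' y'"
proof -
  obtain a where a: "a \<in> emv_idem" "x' \<le> a" "y' \<le> a"
    using ex_idem_above2 by blast
  have "x \<le> a" "y \<le> a"
    using a assms by auto
  with a assms show ?thesis
    by (auto simp: odot_eq[of a] intro!: lam_antimono add_mono add_le_idem lam_le)
qed

lemma odot_le: "emv_odot x y \<le> inf x y"
proof -
  obtain a where a: "a \<in> emv_idem" "x \<le> a" "y \<le> a"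
    using ex_idem_above2 by blast
  have "lam a (lam a x + lam a y) \<le> lam a (lam a x)" "lam a (lam a x + lam a y) \<le> lam a (lam a y)"
    using a by (auto intro!: lam_antimono add_le_idem lam_le le_add_left le_add_right)
  with a show ?thesis
    by (simp add: odot_eq[of a] lam_lam)
qed

lemma odot_idem: "a \<in> emv_idem \<Longrightarrow> emv_odot a a = a"
  by (simp add: odot_eq[of a] lam_idem lam_zero)

lemma odot_lam: "\<lbrakk>a \<in> emv_idem; x \<le> a\<rbrakk> \<Longrightarrow> emv_odot x (lam a x) = 0"
  by (simp add: odot_eq[of a] lam_le lam_lam add_commute[of "lam a x" x] add_lam lam_idem)

section \<open>Filters and their associated ideals\<close>

lemma filter_up: "\<lbrakk>emv_filter F; x \<in> F; x \<le> y\<rbrakk> \<Longrightarrow> y \<in> F"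
  unfolding emv_filter_def by blast

lemma filter_odot: "\<lbrakk>emv_filter F; x \<in> F; y \<in> F\<rbrakk> \<Longrightarrow> emv_odot x y \<in> F"
  unfolding emv_filter_def by blast

lemma filter_inf: "\<lbrakk>emv_filter F; x \<in> F; y \<in> F\<rbrakk> \<Longrightarrow> inf x y \<in> F"
  using filter_up filter_odot odot_le by metis

lemma filter_proper_iff: "emv_filter F \<Longrightarrow> F \<noteq> UNIV \<longleftrightarrow> 0 \<notin> F"
  using filter_up zero_least by blast

text \<open>Involution turns the image in the definition into a preimage condition, which suits the
  closure proofs.\<close>

lemma mem_ideal_of_iff:
  "y \<in> emv_ideal_of F \<longleftrightarrow> (\<exists>a\<in>emv_idem. y \<le> a \<and> lam a y \<in> F)"
proof
  assume "y \<in> emv_ideal_of F"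
  then obtain x a where "y = lam a x" "x \<in> F" "a \<in> emv_idem" "x \<le> a"
    by (auto simp: emv_ideal_of_def)
  then show "\<exists>a\<in>emv_idem. y \<le> a \<and> lam a y \<in> F"
    using lam_le lam_lam by force
next
  assume "\<exists>a\<in>emv_idem. y \<le> a \<and> lam a y \<in> F"
  then obtain a where "a \<in> emv_idem" "y \<le> a" "lam a y \<in> F"
    by blast
  then show "y \<in> emv_ideal_of F"
    unfolding emv_ideal_of_def using lam_le[of a y] lam_lam[of a y, symmetric] by blast
qed

lemma ideal_ideal_of:
  assumes F: "emv_filter F"
  shows "emv_ideal (emv_ideal_of F)"
  unfolding emv_ideal_def
proof (intro conjI allI impI ballI)
  obtain x where x: "x \<in> F"
    using F by (auto simp: emv_filter_def)
  obtain a where "a \<in> emv_idem" "x \<le> a"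
    using idem_above by blast
  with x show "emv_ideal_of F \<noteq> {}"
    unfolding emv_ideal_of_def by blast
next
  fix x y assume "y \<in> emv_ideal_of F \<and> x \<le> y"
  then obtain a where a: "a \<in> emv_idem" "y \<le> a" "lam a y \<in> F" "x \<le> y"
    by (auto simp: mem_ideal_of_iff)
  then have "lam a x \<in> F"
    using filter_up[OF F] lam_antimono by blast
  with a show "x \<in> emv_ideal_of F"
    by (meson mem_ideal_of_iff order.trans)
next
  fix x y assume "x \<in> emv_ideal_of F" "y \<in> emv_ideal_of F"
  then obtain a b where a: "a \<in> emv_idem" "x \<le> a" "lam a x \<in> F"
    and b: "b \<in> emv_idem" "y \<le> b" "lam b y \<in> F"
    by (auto simp: mem_ideal_of_iff)
  obtain c where c: "c \<in> emv_idem" "a \<le> c" "b \<le> c"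
    using ex_idem_above2 by blast
  have xy: "x \<le> c" "y \<le> c"
    using a b c by auto
  \<comment> \<open>Complements grow with the idempotent, so both witnesses move up to
    \<open>c\<close>, where De Morgan (\<open>odot_lam_lam\<close>) applies.\<close>
  have "lam c x \<in> F" "lam c y \<in> F"
    using a b c filter_up[OF F] lam_mono_idem by blast+
  then have "lam c (x + y) \<in> F"
    using filter_odot[OF F] odot_lam_lam[OF c(1) xy] by metis
  then show "x + y \<in> emv_ideal_of F"
    using c add_le_idem xy by (auto simp: mem_ideal_of_iff)
qed

text \<open>A common element \<open>y\<close> would put \<open>emv_odot y (lam a y) = 0\<close> into
  \<open>F\<close>. This makes the associated ideal proper.\<close>

lemma ideal_of_disjoint:
  assumes F: "emv_filter F" "F \<noteq> UNIV"
  shows "F \<inter> emv_ideal_of F = {}"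
proof -
  have False if y: "y \<in> F" "y \<in> emv_ideal_of F" for y
  proof -
    obtain a where "a \<in> emv_idem" "y \<le> a" "lam a y \<in> F"
      using y by (auto simp: mem_ideal_of_iff)
    then have "0 \<in> F"
      using filter_odot[OF F(1) y(1)] odot_lam by metis
    then show False
      using F filter_proper_iff by blast
  qed
  then show ?thesis
    by blast
qed

text \<open>The dual of \<open>J\<close> relative to \<open>a\<close>, closed upwards to reach
  beyond \<open>[0,a]\<close>. It is the set of all \<open>z\<close> with
  \<open>lam a (inf z a) \<in> J\<close>; that complement serves as \<open>w\<close>.\<close>

lemma filter_of_ideal:
  assumes J: "emv_ideal J" and a: "a \<in> emv_idem"
  shows "emv_filter {z. \<exists>w\<in>J. w \<le> a \<and> lam a w \<le> z}" (is "emv_filter ?G")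
  unfolding emv_filter_def
proof (intro conjI allI impI ballI)
  have "0 \<in> J"
    using J zero_least unfolding emv_ideal_def by blast
  then show "?G \<noteq> {}"
    using zero_least by blast
next
  fix x y assume "x \<in> ?G \<and> x \<le> y"
  then show "y \<in> ?G"
    using order.trans by blast
next
  fix x y assume "x \<in> ?G" "y \<in> ?G"
  then obtain u v where u: "u \<in> J" "u \<le> a" "lam a u \<le> x" and v: "v \<in> J" "v \<le> a" "lam a v \<le> y"
    by blast
  have "u + v \<in> J"
    using J u v unfolding emv_ideal_def by blast
  moreover have "lam a (u + v) \<le> emv_odot x y"
    using odot_mono[OF u(3) v(3)] odot_lam_lam[OF a u(2) v(2)] by simp
  ultimately show "emv_odot x y \<in> ?G"
    using u v a add_le_idem by blast
qed

lemma maximal_ideal_of: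
  assumes "emv_maximal_filter F"
  shows "emv_maximal_ideal (emv_ideal_of F)"
proof -
  have F: "emv_filter F" "F \<noteq> UNIV"
    and max: "\<And>G. \<lbrakk>emv_filter G; F \<subset> G\<rbrakk> \<Longrightarrow> G = UNIV"
    using assms by (auto simp: emv_maximal_filter_def)
  obtain f where f: "f \<in> F"
    using F by (auto simp: emv_filter_def)
  \<comment> \<open>The hull is the intersection of all such \<open>J\<close>, so each of them has
    to be everything.\<close>
  have "z \<in> J" if x: "x \<notin> emv_ideal_of F"
    and J: "emv_ideal J" "emv_ideal_of F \<union> {x} \<subseteq> J" for x z J
  proof -
    \<comment> \<open>\<open>f \<le> a\<close> forces \<open>a \<in> F\<close>, and
      \<open>z \<le> a\<close> reduces the goal to \<open>a \<in> J\<close>.\<close>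
    obtain a where a: "a \<in> emv_idem" "x \<le> a" "z \<le> a" "f \<le> a"
      using ex_idem_above3 by blast
    have aF: "a \<in> F"
      using filter_up F f a by blast
    let ?G = "{z. \<exists>w\<in>J. w \<le> a \<and> lam a w \<le> z}"
    have "F \<subseteq> ?G"
    proof
      fix g assume "g \<in> F"
      then have "inf g a \<in> F"
        using F aF filter_inf by blast
      then have "lam a (inf g a) \<in> emv_ideal_of F"
        using a inf.cobounded2 unfolding emv_ideal_of_def by blast
      then have "lam a (inf g a) \<in> J"
        using J by blast
      then show "g \<in> ?G"
        using a by (auto intro!: bexI[of _ "lam a (inf g a)"] simp: lam_lam lam_le)
    qed
    \<comment> \<open>Take \<open>x\<close> itself as \<open>w\<close>.\<close>
    moreover have "lam a x \<in> ?G"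
      using J a by auto
    moreover have "lam a x \<notin> F"
      using x a by (auto simp: mem_ideal_of_iff)
    ultimately have "?G = UNIV"
      using max[OF filter_of_ideal[OF J(1) a(1)]] by blast
    then obtain w where w: "w \<in> J" "w \<le> a" "lam a w \<le> 0"
      by blast
    then have "lam a w = 0"
      using zero_least order.antisym by blast
    then have "w = a"
      using w a lam_lam lam_zero by metis
    then show "z \<in> J"
      using w a J unfolding emv_ideal_def by blast
  qed
  then have "emv_ideal hull (emv_ideal_of F \<union> {x}) = UNIV" if "x \<notin> emv_ideal_of F" for x
    using that unfolding hull_def by blast
  moreover have "emv_ideal_of F \<noteq> UNIV"
    using ideal_of_disjoint[OF F] f by blast
  ultimately show ?thesis
    using ideal_ideal_of[OF F(1)] by (simp add: emv_maximal_ideal_def)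
qed

section \<open>Existence of maximal filters\<close>

lemma ex_maximal_filter:
  assumes "x \<noteq> 0"
  shows "\<exists>F. emv_maximal_filter F"
proof -
  obtain a where a: "a \<in> emv_idem" "x \<le> a"
    using idem_above by blast
  then have "a \<noteq> 0"
    using assms zero_least order.antisym by blast
  let ?P = "{F. emv_filter F \<and> 0 \<notin> F}"
  \<comment> \<open>Zorn's lemma needs one proper filter: the up-set of a nonzero idempotent is
    closed under \<odot> because \<open>emv_odot a a = a\<close>.\<close>
  have "emv_odot u v \<in> {a..}" if "u \<in> {a..}" "v \<in> {a..}" for u v
    using odot_mono[of a u a v] that a by (simp add: odot_idem)
  then have "emv_filter {a..}"
    unfolding emv_filter_def by auto
  then have "{a..} \<in> ?P"
    using \<open>a \<noteq> 0\<close> zero_least order.antisym by auto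
  then have "?P \<noteq> {}"
    by blast
  moreover have "\<Union>C \<in> ?P" if "C \<noteq> {}" and C: "subset.chain ?P C" for C
  proof -
    have sub: "C \<subseteq> ?P" and lin: "\<And>X Y. \<lbrakk>X \<in> C; Y \<in> C\<rbrakk> \<Longrightarrow> X \<subseteq> Y \<or> Y \<subseteq> X"
      using C by (auto simp: subset_chain_def)
    have "emv_odot u v \<in> \<Union>C" if uv: "u \<in> \<Union>C" "v \<in> \<Union>C" for u v
    proof -
      obtain X Y where "X \<in> C" "Y \<in> C" "u \<in> X" "v \<in> Y"
        using uv by blast
      then obtain Z where "Z \<in> C" "u \<in> Z" "v \<in> Z"
        using lin by blast
      then show ?thesis
        using sub filter_odot by blast
    qed
    moreover have "\<Union>C \<noteq> {}"
      using \<open>C \<noteq> {}\<close> sub unfolding emv_filter_def by blast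
    moreover have "v \<in> \<Union>C" if "u \<in> \<Union>C" "u \<le> v" for u v
      using that sub filter_up by blast
    ultimately have "emv_filter (\<Union>C)"
      unfolding emv_filter_def by blast
    then show ?thesis
      using sub by blast
  qed
  ultimately obtain F where F: "F \<in> ?P" "\<And>X. \<lbrakk>X \<in> ?P; F \<subseteq> X\<rbrakk> \<Longrightarrow> X = F"
    using subset_Zorn_nonempty[of ?P] by blast
  have "emv_maximal_filter F"
    unfolding emv_maximal_filter_def
    using F filter_proper_iff by blast
  then show ?thesis
    by blast
qed

end

theorem theorem5p6:
  assumes proper: "\<not> (\<exists>t :: 'a :: emv_algebra. \<forall>x. x \<le> t)"
  shows "(\<exists>I :: 'a set. emv_maximal_ideal I) \<and>
    (\<forall>F :: 'a set. emv_maximal_filter F \<longrightarrow> emv_maximal_ideal (emv_ideal_of F))"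
proof -
  \<comment> \<open>Otherwise \<open>0\<close> would be the greatest element.\<close>
  obtain x :: 'a where "\<not> x \<le> 0"
    using proper by blast
  then have "x \<noteq> 0"
    by auto
  then show ?thesis
    using ex_maximal_filter maximal_ideal_of by blast
qed

end
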